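(* Suppose there is a $(v,k,\lambda)$-difference set $D$ in a group $G$ of order $v$. Then $(D,G-D^{(-1)})$ is a $(k,v-k)$-$(k-\lambda)$-fold near-factorization of $G$, where $D^{(-1)}=\{d^{-1}:d\in D\}$ and $G-D^{(-1)}$ denotes the subset $G\setminus D^{(-1)}$.
   Context: Subsets of $G$ are identified with the sums of their elements in the group ring $\mathbb{Z}[G]$; $e$ is the identity of $G$. A $(v,k,\lambda)$-difference set in a group $G$ of order $v$ is a subset $D\subseteq G$ with $|D|=k$ and $DD^{(-1)}=k\cdot e+\lambda(G-e)$ in $\mathbb{Z}[G]$. For $S,T\subseteq G$ and an integer $\mu$, $(S,T)$ is an $(s,t)$-$\mu$-fold near-factorization of $G$ if $|S|=s$, $|T|=t$ and $ST=\mu(G-e)$ in $\mathbb{Z}[G]$; that is, every non-identity element of $G$ can be written as $xy$ with $x\in S$, $y\in T$ in exactly $\mu$ ways, and $xy\ne e$ for all $x\in S$, $y\in T$. *)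

theory Defs
  imports "HOL-Algebra.Free_Abelian_Groups"
begin

text \<open>
  The additive group of the integral group ring of \<open>G\<close> is the library's free Abelian group on
  \<open>carrier G\<close>, whose elements are finitely supported functions of type \<open>'a \<Rightarrow>\<^sub>0 int\<close>:
  \<^term>\<open>frag_of\<close> is the basis element of a group element and \<^const>\<open>frag_cmul\<close> is
  multiplication by an integer.  The product is the bilinear extension of the group operation.
\<close>

definition group_ring_mult ::
    "('a, 'b) monoid_scheme \<Rightarrow> ('a \<Rightarrow>\<^sub>0 int) \<Rightarrow> ('a \<Rightarrow>\<^sub>0 int) \<Rightarrow> ('a \<Rightarrow>\<^sub>0 int)"
    (infixl \<open>\<odot>\<index>\<close> 70)
  where "a \<odot>\<^bsub>G\<^esub> b = frag_extend (\<lambda>x. frag_extend (\<lambda>y. frag_of (x \<otimes>\<^bsub>G\<^esub> y)) b) a"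

text \<open>The sum is intended for finite \<open>S\<close> only; it is zero for infinite \<open>S\<close>.\<close>

definition set_sum :: "'a set \<Rightarrow> ('a \<Rightarrow>\<^sub>0 int)"
  where "set_sum S = (\<Sum>x\<in>S. frag_of x)"

definition difference_set ::
    "('a, 'b) monoid_scheme \<Rightarrow> nat \<Rightarrow> nat \<Rightarrow> int \<Rightarrow> 'a set \<Rightarrow> bool"
  where "difference_set G v k lam D \<longleftrightarrow>
    group G \<and> finite (carrier G) \<and> order G = v \<and> D \<subseteq> carrier G \<and> card D = k \<and>
    set_sum D \<odot>\<^bsub>G\<^esub> set_sum (set_inv\<^bsub>G\<^esub> D) =
      frag_cmul (int k) (frag_of \<one>\<^bsub>G\<^esub>) +
      frag_cmul lam (set_sum (carrier G) - frag_of \<one>\<^bsub>G\<^esub>)"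

definition near_factorization ::
    "('a, 'b) monoid_scheme \<Rightarrow> nat \<Rightarrow> nat \<Rightarrow> int \<Rightarrow> 'a set \<Rightarrow> 'a set \<Rightarrow> bool"
  where "near_factorization G s t \<mu> S T \<longleftrightarrow>
    group G \<and> finite (carrier G) \<and> S \<subseteq> carrier G \<and> T \<subseteq> carrier G \<and> card S = s \<and> card T = t \<and>
    set_sum S \<odot>\<^bsub>G\<^esub> set_sum T = frag_cmul \<mu> (set_sum (carrier G) - frag_of \<one>\<^bsub>G\<^esub>)"

text \<open>The coefficients of a product of two subsets count representations as \<open>x \<otimes> y\<close>.\<close>

lemma frag_extend_set_sum:
  assumes "finite S"
  shows "frag_extend f (set_sum S) = (\<Sum>x\<in>S. f x)"
  using assms unfolding set_sum_def by (induction S) (auto simp: frag_extend_add)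

lemma lookup_set_sum_mult:
  assumes "finite S" "finite T"
  shows "poly_mapping.lookup (set_sum S \<odot>\<^bsub>G\<^esub> set_sum T) g =
    int (card {(x, y) \<in> S \<times> T. x \<otimes>\<^bsub>G\<^esub> y = g})"
proof -
  have "poly_mapping.lookup (set_sum S \<odot>\<^bsub>G\<^esub> set_sum T) g =
      (\<Sum>x\<in>S. \<Sum>y\<in>T. if x \<otimes>\<^bsub>G\<^esub> y = g then 1 else 0)"
    using assms
    by (simp add: group_ring_mult_def frag_extend_set_sum lookup_sum lookup_frag_of eq_commute)
  also have "\<dots> = (\<Sum>(x, y)\<in>S \<times> T. if x \<otimes>\<^bsub>G\<^esub> y = g then 1 else 0)"
    by (simp add: sum.cartesian_product)
  also have "\<dots> = (\<Sum>p\<in>S \<times> T. if p \<in> {(x, y). x \<otimes>\<^bsub>G\<^esub> y = g} then 1 else 0)"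
    by (intro sum.cong) auto
  also have "\<dots> = int (card (S \<times> T \<inter> {(x, y). x \<otimes>\<^bsub>G\<^esub> y = g}))"
    using assms by (subst sum.inter_restrict [symmetric]) auto
  also have "S \<times> T \<inter> {(x, y). x \<otimes>\<^bsub>G\<^esub> y = g} = {(x, y) \<in> S \<times> T. x \<otimes>\<^bsub>G\<^esub> y = g}"
    by auto
  finally show ?thesis .
qed

end

theory Submission
  imports Defs
begin

text \<open>Work in the group ring, where the complement of D^(-1) is the difference G - D^(-1). By
  linearity in the right factor, D(G - D^(-1)) = DG - DD^(-1). Every x in D satisfies xG = G, so DG
  = kG (\<open>set_sum_mult_carrier\<close>), and the difference set equation supplies DD^(-1). What
  remains is kG - ke - lam(G - e) = (k - lam)(G - e). The size v - k comes from injectivity of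
  inversion.\<close>

text \<open>Expanding only the left factor leaves a sum of maps additive in \<open>b\<close>, from
  which linearity on the right follows termwise.\<close>

lemma group_ring_mult_set_sum_left:
  assumes "finite S"
  shows "set_sum S \<odot>\<^bsub>G\<^esub> b = (\<Sum>x\<in>S. frag_extend (\<lambda>y. frag_of (x \<otimes>\<^bsub>G\<^esub> y)) b)"
  using assms by (simp add: group_ring_mult_def frag_extend_set_sum)

lemma set_sum_Diff:
  assumes "finite S" "T \<subseteq> S"
  shows "set_sum (S - T) = set_sum S - set_sum T"
  using assms by (simp add: set_sum_def sum_diff)

lemma set_sum_mult_diff:
  assumes "finite S"
  shows "set_sum S \<odot>\<^bsub>G\<^esub> (b - c) = set_sum S \<odot>\<^bsub>G\<^esub> b - set_sum S \<odot>\<^bsub>G\<^esub> c"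
  using assms by (simp add: group_ring_mult_set_sum_left frag_extend_diff sum_subtractf)

lemma (in group) bij_betw_mult_left:
  assumes "x \<in> carrier G"
  shows "bij_betw ((\<otimes>) x) (carrier G) (carrier G)"
  using assms by (simp add: bij_betw_def inj_on_cmult surj_const_mult)

text \<open>An infinite \<open>S\<close> gives zero on both sides, by the conventions for sums and
  \<open>card\<close>.\<close>

lemma sum_const_frag_cmul: "(\<Sum>x\<in>S. a) = frag_cmul (int (card S)) a"
  by (induction S rule: infinite_finite_induct) (auto simp: frag_cmul_distrib)

text \<open>Left translation by an element of \<open>S\<close> permutes the group, so each such
  element contributes one full copy of the group sum.\<close>

lemma (in group) set_sum_mult_carrier:
  assumes fin: "finite (carrier G)" and S: "S \<subseteq> carrier G"
  shows "set_sum S \<odot> set_sum (carrier G) = frag_cmul (int (card S)) (set_sum (carrier G))"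
proof -
  have "(\<Sum>y\<in>carrier G. frag_of (x \<otimes> y)) = set_sum (carrier G)" if "x \<in> S" for x
    unfolding set_sum_def using that S
    by (intro sum.reindex_bij_betw bij_betw_mult_left) auto
  with fin S show ?thesis
    by (simp add: group_ring_mult_set_sum_left frag_extend_set_sum finite_subset
        sum_const_frag_cmul)
qed

lemma (in group) SET_INV_eq_image: "set_inv S = m_inv G ` S"
  by (auto simp: SET_INV_def)

theorem theorem2p1:
  fixes G :: "('a, 'b) monoid_scheme" (structure)
    and v k :: nat and lam :: int and D :: "'a set"
  assumes "group G" and "finite (carrier G)" and "order G = v"
    and "difference_set G v k lam D"
  shows "near_factorization G k (v - k) (int k - lam) D (carrier G - set_inv D)"
proof -
  interpret group G by fact
  have D: "D \<subseteq> carrier G" and k: "card D = k"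
    and prod: "set_sum D \<odot> set_sum (set_inv D) =
      frag_cmul (int k) (frag_of \<one>) + frag_cmul lam (set_sum (carrier G) - frag_of \<one>)"
    using assms by (auto simp: difference_set_def)
  have inv_sub: "set_inv D \<subseteq> carrier G"
    using D by (auto simp: SET_INV_eq_image)
  have finD: "finite D"
    using D assms(2) finite_subset by blast
  have "card (set_inv D) = k"
    using D k by (metis SET_INV_eq_image card_image inj_on_subset inv_inj)
  hence card: "card (carrier G - set_inv D) = v - k"
    using assms(2,3) inv_sub by (metis card_Diff_subset finite_subset order_def)
  have "set_sum D \<odot> set_sum (carrier G - set_inv D) =
      frag_cmul (int k) (set_sum (carrier G)) - set_sum D \<odot> set_sum (set_inv D)"
    using assms(2) D k inv_sub finD
    by (simp add: set_sum_Diff set_sum_mult_diff set_sum_mult_carrier)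
  \<comment> \<open>The identity term of \<open>prod\<close>, with coefficient \<open>k\<close>,
    turns kG into k(G - e), which then combines with the \<open>lam\<close> term.\<close>
  also have "\<dots> = frag_cmul (int k - lam) (set_sum (carrier G) - frag_of \<one>)"
    by (simp add: prod frag_cmul_diff_distrib algebra_simps flip: frag_cmul_distrib2)
  finally show ?thesis
    using assms(1,2) D k inv_sub card by (auto simp: near_factorization_def)
qed

end
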